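(* Let $f(X)\in\mathbb{F}_2[[X]]$ be a formal power series with coefficients in $\mathbb{F}_2$. Suppose there exist a polynomial $P(X)\in\mathbb{F}_2[X]$ and an integer $r\ge 1$ such that $$f(X)=\frac{P(X)}{1+X+X^r}\qquad\text{or}\qquad f(X)=\frac{P(X)}{X^r(1+X)+1}.$$ Then for every integer $l\ge 1$ there exist a polynomial $P_l(X)\in\mathbb{F}_2[X]$ and an integer $r_l\ge 1$ such that either $$f(X)=\frac{P_l(X)}{(1+X)^l+X^{r_l}}\qquad\text{or}\qquad f(X)=\frac{P_l(X)}{X^{r_l}(1+X)^l+1}.$$
   Context: An equality $f=P/D$ with $P,D\in\mathbb{F}_2[X]$ means $D(X)f(X)=P(X)$ in $\mathbb{F}_2[[X]]$. *)

theory Defs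
  imports "HOL-Library.Z2" "HOL-Computational_Algebra.Computational_Algebra"
begin

text \<open>The field with two elements is \<^typ>\<open>bit\<close>. The quotient notation f = P / D is read as the
  identity D f = P of formal power series (and not via the total division on \<^typ>\<open>bit fps\<close>).\<close>

definition eq_quotient :: "bit fps \<Rightarrow> bit poly \<Rightarrow> bit poly \<Rightarrow> bool" where
  "eq_quotient f P D \<longleftrightarrow> fps_of_poly D * f = fps_of_poly P"

abbreviation X :: "bit poly" where
  "X \<equiv> [:0, 1:]"

end

theory Submission imports Defs begin

text \<open>Over the field with two elements a + b = a - b, so a + b divides a^l + b^l
  (\<open>add_dvd_power_add_power\<close>). Both given denominators have the form a + b, with (a, b)
  = (1 + X, X^r) or (X^r (1 + X), 1), and a^l + b^l is then a denominator of the required form with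
  exponent r * l. A fraction can be extended to any multiple of its denominator
  (\<open>eq_quotient_dvd\<close>).\<close>

lemma bit_poly_diff_eq_add: "p - q = p + (q :: bit poly)"
  by (simp add: poly_eq_iff)

text \<open>Without signs, this is the factorisation of a^l - b^l as a - b times the sum of the a^i
  b^j with i + j = l - 1.\<close>

lemma add_dvd_power_add_power:
  fixes a b :: "bit poly"
  shows "a + b dvd a ^ l + b ^ l"
  unfolding bit_poly_diff_eq_add [symmetric]
  by (simp add: power_diff_sumr2)

text \<open>If E = D C, multiplying D f = P by C gives E f = P C, so P C serves as
  numerator.\<close>

lemma eq_quotient_dvd:
  assumes "eq_quotient f P D" and "D dvd E"
  shows "\<exists>Q. eq_quotient f Q E"
proof -
  obtain C where "E = D * C"
    using assms(2) by (rule dvdE)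
  then have "eq_quotient f (P * C) E"
    using assms(1) unfolding eq_quotient_def
    by (metis fps_of_poly_mult mult.assoc mult.commute)
  then show ?thesis ..
qed

theorem theorem3:
  fixes f :: "bit fps"
  assumes "\<exists>(P :: bit poly) (r :: nat). r \<ge> 1 \<and>
    (eq_quotient f P (1 + X + X ^ r) \<or> eq_quotient f P (X ^ r * (1 + X) + 1))"
  shows "\<forall>l :: nat. l \<ge> 1 \<longrightarrow> (\<exists>(P_l :: bit poly) (r_l :: nat). r_l \<ge> 1 \<and>
    (eq_quotient f P_l ((1 + X) ^ l + X ^ r_l) \<or> eq_quotient f P_l (X ^ r_l * (1 + X) ^ l + 1)))"
proof (intro allI impI)
  fix l :: nat
  assume "l \<ge> 1"
  obtain P r where "r \<ge> 1" and
    f: "eq_quotient f P (1 + X + X ^ r) \<or> eq_quotient f P (X ^ r * (1 + X) + 1)"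
    using assms by blast
  \<comment> \<open>The exponent r * l comes from (X^r)^l; it serves in both cases, so each of the
    two forms of denominator is preserved.\<close>
  have "1 + X + X ^ r dvd (1 + X) ^ l + X ^ (r * l)"
    using add_dvd_power_add_power [of "1 + X" "X ^ r" l] unfolding power_mult .
  moreover have "X ^ r * (1 + X) + 1 dvd X ^ (r * l) * (1 + X) ^ l + 1"
    using add_dvd_power_add_power [of "X ^ r * (1 + X)" 1 l]
    unfolding power_mult power_mult_distrib power_one .
  ultimately have "\<exists>Q. eq_quotient f Q ((1 + X) ^ l + X ^ (r * l)) \<or>
      eq_quotient f Q (X ^ (r * l) * (1 + X) ^ l + 1)"
    using f eq_quotient_dvd by blast
  moreover have "r * l \<ge> 1"
    using \<open>r \<ge> 1\<close> \<open>l \<ge> 1\<close> by simp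
  ultimately show "\<exists>(P_l :: bit poly) (r_l :: nat). r_l \<ge> 1 \<and>
    (eq_quotient f P_l ((1 + X) ^ l + X ^ r_l) \<or> eq_quotient f P_l (X ^ r_l * (1 + X) ^ l + 1))"
    by blast
qed

end
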